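(* Let $\Psi:[0,1]\to\mathbb{C}^d$ be a continuous path which is fractionally continuable at $t_0\in(0,1)$, let $\Theta: B_\epsilon(t_0)\to\mathbb{C}^d\setminus\{0\}$ be the fractional continuation of $\Psi$ at $t_0$, and let $i\in A$ be the selected component. Then for an arbitrary infinitesimal $\Delta t\in\mathbb{I}_{\mathbb{R}}\setminus\{0\}$ and every $j=1,\dots,d$, $$\Theta_j(t_0)=\mathbf{sh}\left(\frac{\Psi_j^*(t_0+\Delta t)}{\Psi_i^*(t_0+\Delta t)}\right).$$
   Context: Fractional continuation. Let $\Psi$ be a continuous $\mathbb{C}^d$-valued path and $t_0$ a point of its domain. Let $A\subset\{1,\dots,d\}$ be the set of indices $j$ such that the component $\Psi_j$ is not constantly $0$ on a neighborhood of $t_0$. $\Psi$ is fractionally continuable at $t_0$ if (1) $A\neq\emptyset$ and (2) for all $i,j\in A$ (including $i=j$), $\Psi_i/\Psi_j$ or $\Psi_j/\Psi_i$ has a removable singularity or is continuous at $t_0$ (i.e. the quotient is defined on a punctured neighborhood of $t_0$ and has a finite limit at $t_0$). In that case there are an index $i\in A$ (the selected component at $t_0$) and $\epsilon>0$ such that $\Psi_i$ has no zero in $B_\epsilon(t_0)\setminus\{t_0\}$ and all quotients $\Psi_j/\Psi_i$, $j=1,\dots,d$, extend continuously to $t_0$. The fractional continuation is the continuous function $\Theta:B_\epsilon(t_0)\to\mathbb{C}^d\setminus\{0\}$ with $\Theta(t)=\Psi(t)/\Psi_i(t)$ for $t\ne t_0$ and with $\Theta(t_0)$ defined by continuous extension;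 $\lambda=\Psi_i$ is called the removable prefactor. Non-standard analysis. $\mathbb{R}^*$ and $\mathbb{C}^*=\mathbb{R}^*+\mathrm{i}\mathbb{R}^*$ are the hyperreal and hypercomplex numbers (a non-standard extension satisfying the transfer principle and containing non-zero infinitesimals, e.g. an ultrapower over a non-principal ultrafilter on $\mathbb{N}$). For a function $f$ on a set $D$, $f^*$ denotes its extension to the enlargement $D^*$. $\mathbb{I}_{\mathbb{R}}$ is the set of hyperreal $\epsilon$ with $|\epsilon|<r$ for all real $r>0$. A hypercomplex number $z$ is limited if $|z|<n$ for some $n\in\mathbb{N}$; every limited $z$ is infinitely close (differs by an infinitesimal) to exactly one complex number, its shadow $\mathbf{sh}(z)$. *)

theory Defs
  imports "HOL-Analysis.Analysis"
begin

section \<open>Fractional continuation\<close>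

text \<open>
  A path is a function on the reals that is only looked at on its domain \<open>S\<close>;
  neighbourhoods of \<open>t0\<close> and limits at \<open>t0\<close> are taken relative to \<open>S\<close>.
\<close>

definition active_components :: "real set \<Rightarrow> (real \<Rightarrow> complex ^ 'd) \<Rightarrow> real \<Rightarrow> 'd set" where
  "active_components S \<Psi> t0 =
     {j. \<not> (\<exists>\<epsilon>>0. \<forall>t \<in> S \<inter> ball t0 \<epsilon>. \<Psi> t $ j = 0)}"

definition removable_quotient ::
    "real set \<Rightarrow> (real \<Rightarrow> complex) \<Rightarrow> (real \<Rightarrow> complex) \<Rightarrow> real \<Rightarrow> bool" where
  "removable_quotient S f g t0 \<longleftrightarrow>
     (\<exists>\<epsilon>>0. \<forall>t \<in> S \<inter> ball t0 \<epsilon> - {t0}. g t \<noteq> 0) \<and>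
     (\<exists>l. ((\<lambda>t. f t / g t) \<longlongrightarrow> l) (at t0 within S))"

definition fractionally_continuable ::
    "real set \<Rightarrow> (real \<Rightarrow> complex ^ 'd) \<Rightarrow> real \<Rightarrow> bool" where
  "fractionally_continuable S \<Psi> t0 \<longleftrightarrow>
     active_components S \<Psi> t0 \<noteq> {} \<and>
     (\<forall>i \<in> active_components S \<Psi> t0. \<forall>j \<in> active_components S \<Psi> t0.
        removable_quotient S (\<lambda>t. \<Psi> t $ i) (\<lambda>t. \<Psi> t $ j) t0 \<or>
        removable_quotient S (\<lambda>t. \<Psi> t $ j) (\<lambda>t. \<Psi> t $ i) t0)"

definition selected_component ::
    "real set \<Rightarrow> (real \<Rightarrow> complex ^ 'd) \<Rightarrow> real \<Rightarrow> real \<Rightarrow> 'd \<Rightarrow> bool" where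
  "selected_component S \<Psi> t0 \<epsilon> i \<longleftrightarrow>
     i \<in> active_components S \<Psi> t0 \<and> \<epsilon> > 0 \<and>
     (\<forall>t \<in> S \<inter> ball t0 \<epsilon> - {t0}. \<Psi> t $ i \<noteq> 0) \<and>
     (\<forall>j. \<exists>l. ((\<lambda>t. \<Psi> t $ j / \<Psi> t $ i) \<longlongrightarrow> l) (at t0 within S))"

text \<open>The value \<open>\<Theta> t0\<close> is pinned down by the continuity of \<open>\<Theta>\<close>.\<close>

definition fractional_continuation ::
    "real set \<Rightarrow> (real \<Rightarrow> complex ^ 'd) \<Rightarrow> real \<Rightarrow> real \<Rightarrow> 'd \<Rightarrow> (real \<Rightarrow> complex ^ 'd) \<Rightarrow> bool" where
  "fractional_continuation S \<Psi> t0 \<epsilon> i \<Theta> \<longleftrightarrow>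
     selected_component S \<Psi> t0 \<epsilon> i \<and>
     continuous_on (S \<inter> ball t0 \<epsilon>) \<Theta> \<and>
     \<Theta> ` (S \<inter> ball t0 \<epsilon>) \<subseteq> UNIV - {0} \<and>
     (\<forall>t \<in> S \<inter> ball t0 \<epsilon> - {t0}. \<Theta> t = (\<chi> j. \<Psi> t $ j / \<Psi> t $ i))"


section \<open>Non-standard extensions of the reals\<close>

text \<open>
  First-order language of the ordered field of reals with a symbol for every real function of
  every arity (arguments are passed as a list; constants are the 0-ary functions).  Relations
  need no symbols of their own, since they are expressible by their indicator functions.  A
  structure is an ordered field together with an interpretation \<open>star\<close> of the function symbols;
  the standard structure interprets each symbol by itself.
\<close>

datatype tm = Var nat | Add tm tm | Mul tm tm | Fun "real list \<Rightarrow> real" "tm list"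

datatype fm = Eq tm tm | Less tm tm | Neg fm | Conj fm fm | All nat fm

primrec tm_val ::
    "((real list \<Rightarrow> real) \<Rightarrow> 'h list \<Rightarrow> 'h) \<Rightarrow> (nat \<Rightarrow> 'h) \<Rightarrow> tm \<Rightarrow> 'h::linordered_field" where
  "tm_val star v (Var n) = v n"
| "tm_val star v (Add s t) = tm_val star v s + tm_val star v t"
| "tm_val star v (Mul s t) = tm_val star v s * tm_val star v t"
| "tm_val star v (Fun f ts) = star f (map (tm_val star v) ts)"

primrec sat ::
    "((real list \<Rightarrow> real) \<Rightarrow> 'h list \<Rightarrow> 'h::linordered_field) \<Rightarrow> (nat \<Rightarrow> 'h) \<Rightarrow> fm \<Rightarrow> bool" where
  "sat star v (Eq s t) \<longleftrightarrow> tm_val star v s = tm_val star v t"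
| "sat star v (Less s t) \<longleftrightarrow> tm_val star v s < tm_val star v t"
| "sat star v (Neg \<phi>) \<longleftrightarrow> \<not> sat star v \<phi>"
| "sat star v (Conj \<phi> \<psi>) \<longleftrightarrow> sat star v \<phi> \<and> sat star v \<psi>"
| "sat star v (All n \<phi>) \<longleftrightarrow> (\<forall>x. sat star (v(n := x)) \<phi>)"

definition hypreal_of ::
    "((real list \<Rightarrow> real) \<Rightarrow> 'h list \<Rightarrow> 'h) \<Rightarrow> real \<Rightarrow> 'h::linordered_field" where
  "hypreal_of star r = star (\<lambda>_. r) []"

definition transfer_principle ::
    "((real list \<Rightarrow> real) \<Rightarrow> 'h list \<Rightarrow> 'h::linordered_field) \<Rightarrow> bool" where
  "transfer_principle star \<longleftrightarrow>
     (\<forall>\<phi> v. sat (\<lambda>f. f) v \<phi> \<longleftrightarrow> sat star (\<lambda>n. hypreal_of star (v n)) \<phi>)"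

definition infinitesimals ::
    "((real list \<Rightarrow> real) \<Rightarrow> 'h list \<Rightarrow> 'h) \<Rightarrow> 'h::linordered_field set" where
  "infinitesimals star = {\<epsilon>. \<forall>r>0. \<bar>\<epsilon>\<bar> < hypreal_of star r}"

definition nonstandard_extension ::
    "((real list \<Rightarrow> real) \<Rightarrow> 'h list \<Rightarrow> 'h::linordered_field) \<Rightarrow> bool" where
  "nonstandard_extension star \<longleftrightarrow>
     transfer_principle star \<and> infinitesimals star - {0} \<noteq> {}"

definition enlargement ::
    "((real list \<Rightarrow> real) \<Rightarrow> 'h list \<Rightarrow> 'h) \<Rightarrow> real set \<Rightarrow> 'h::linordered_field set" where
  "enlargement star D = {x. star (\<lambda>xs. if hd xs \<in> D then 1 else 0) [x] = 1}"


section \<open>Hypercomplex numbers\<close>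

datatype 'h hypcomplex = HComplex (hRe: 'h) (hIm: 'h)

instantiation hypcomplex :: (linordered_field) field
begin

definition zero_hypcomplex :: "'a hypcomplex"
  where "0 = HComplex 0 0"

definition one_hypcomplex :: "'a hypcomplex"
  where "1 = HComplex 1 0"

definition plus_hypcomplex :: "'a hypcomplex \<Rightarrow> 'a hypcomplex \<Rightarrow> 'a hypcomplex"
  where "z + w = HComplex (hRe z + hRe w) (hIm z + hIm w)"

definition uminus_hypcomplex :: "'a hypcomplex \<Rightarrow> 'a hypcomplex"
  where "- z = HComplex (- hRe z) (- hIm z)"

definition minus_hypcomplex :: "'a hypcomplex \<Rightarrow> 'a hypcomplex \<Rightarrow> 'a hypcomplex"
  where "z - w = HComplex (hRe z - hRe w) (hIm z - hIm w)"

definition times_hypcomplex :: "'a hypcomplex \<Rightarrow> 'a hypcomplex \<Rightarrow> 'a hypcomplex"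
  where "z * w = HComplex (hRe z * hRe w - hIm z * hIm w) (hRe z * hIm w + hIm z * hRe w)"

definition inverse_hypcomplex :: "'a hypcomplex \<Rightarrow> 'a hypcomplex"
  where "inverse z =
    HComplex (hRe z / ((hRe z)\<^sup>2 + (hIm z)\<^sup>2)) (- hIm z / ((hRe z)\<^sup>2 + (hIm z)\<^sup>2))"

definition divide_hypcomplex :: "'a hypcomplex \<Rightarrow> 'a hypcomplex \<Rightarrow> 'a hypcomplex"
  where "z div w = z * inverse (w :: 'a hypcomplex)"

instance
proof
  fix z :: "'a hypcomplex"
  assume "z \<noteq> 0"
  then have "(hRe z)\<^sup>2 + (hIm z)\<^sup>2 \<noteq> 0"
    by (cases z) (auto simp: zero_hypcomplex_def sum_power2_eq_zero_iff)
  then show "inverse z * z = 1"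
    by (simp add: inverse_hypcomplex_def times_hypcomplex_def one_hypcomplex_def
        add_divide_distrib[symmetric] power2_eq_square)
qed (auto simp: zero_hypcomplex_def one_hypcomplex_def plus_hypcomplex_def uminus_hypcomplex_def
      minus_hypcomplex_def times_hypcomplex_def inverse_hypcomplex_def divide_hypcomplex_def
      algebra_simps)

end

definition hypcomplex_of ::
    "((real list \<Rightarrow> real) \<Rightarrow> 'h list \<Rightarrow> 'h) \<Rightarrow> complex \<Rightarrow> 'h::linordered_field hypcomplex" where
  "hypcomplex_of star z = HComplex (hypreal_of star (Re z)) (hypreal_of star (Im z))"

definition fun_extension ::
    "((real list \<Rightarrow> real) \<Rightarrow> 'h list \<Rightarrow> 'h) \<Rightarrow> (real \<Rightarrow> complex) \<Rightarrow>
     'h::linordered_field \<Rightarrow> 'h hypcomplex" where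
  "fun_extension star f x =
     HComplex (star (\<lambda>xs. Re (f (hd xs))) [x]) (star (\<lambda>xs. Im (f (hd xs))) [x])"

definition hypcmod ::
    "((real list \<Rightarrow> real) \<Rightarrow> 'h list \<Rightarrow> 'h) \<Rightarrow> 'h::linordered_field hypcomplex \<Rightarrow> 'h" where
  "hypcmod star z = star (\<lambda>xs. cmod (Complex (xs ! 0) (xs ! 1))) [hRe z, hIm z]"

definition limited ::
    "((real list \<Rightarrow> real) \<Rightarrow> 'h list \<Rightarrow> 'h) \<Rightarrow> 'h::linordered_field hypcomplex \<Rightarrow> bool" where
  "limited star z \<longleftrightarrow> (\<exists>n::nat. hypcmod star z < of_nat n)"

definition infinitely_close ::
    "((real list \<Rightarrow> real) \<Rightarrow> 'h list \<Rightarrow> 'h) \<Rightarrow>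
     'h::linordered_field hypcomplex \<Rightarrow> 'h hypcomplex \<Rightarrow> bool" where
  "infinitely_close star z w \<longleftrightarrow> hypcmod star (z - w) \<in> infinitesimals star"

text \<open>Only meaningful for limited arguments.\<close>

definition shadow ::
    "((real list \<Rightarrow> real) \<Rightarrow> 'h list \<Rightarrow> 'h) \<Rightarrow> 'h::linordered_field hypcomplex \<Rightarrow> complex" where
  "shadow star z = (THE w. infinitely_close star z (hypcomplex_of star w))"

end

theory Submission imports Defs begin

text \<open>
  A first-order formula that holds for all \<open>t\<close> in a punctured neighbourhood of \<open>t0\<close> holds, by
  transfer, at \<open>t0 + \<Delta>t\<close> for every non-zero infinitesimal \<open>\<Delta>t\<close>.  Each of
  \<open>t \<in> [0,1]\<close>, \<open>\<Psi>\<^sub>i t \<noteq> 0\<close> and \<open>\<bar>\<Psi>\<^sub>j t / \<Psi>\<^sub>i t - \<Theta>\<^sub>j t0\<bar> < r\<close> is such a formula, the last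
  one for every real \<open>r > 0\<close> by continuity of \<open>\<Theta>\<close> at \<open>t0\<close>.
\<close>

lemma transferD:
  assumes "transfer_principle star" "sat (\<lambda>f. f) v \<phi>"
  shows "sat star (\<lambda>n. hypreal_of star (v n)) \<phi>"
  using assms by (simp add: transfer_principle_def)

abbreviation const :: "real \<Rightarrow> tm" where
  "const r \<equiv> Fun (\<lambda>_. r) []"

context
  fixes star :: "(real list \<Rightarrow> real) \<Rightarrow> 'h::linordered_field list \<Rightarrow> 'h"
  assumes transfer: "transfer_principle star"
begin

lemma star_const: "star (\<lambda>_. r) [] = hypreal_of star r"
  by (simp add: hypreal_of_def)

lemma hypreal_of_add: "hypreal_of star (a + b) = hypreal_of star a + hypreal_of star b"
  using transferD[OF transfer, of "\<lambda>_. 0" "Eq (const (a + b)) (Add (const a) (const b))"]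
  by (simp add: star_const)

lemma hypreal_of_mult: "hypreal_of star (a * b) = hypreal_of star a * hypreal_of star b"
  using transferD[OF transfer, of "\<lambda>_. 0" "Eq (const (a * b)) (Mul (const a) (const b))"]
  by (simp add: star_const)

lemma hypreal_of_less: "a < b \<Longrightarrow> hypreal_of star a < hypreal_of star b"
  using transferD[OF transfer, of "\<lambda>_. 0" "Less (const a) (const b)"]
  by (simp add: star_const)

lemma hypreal_of_0: "hypreal_of star 0 = 0"
  using hypreal_of_add[of 0 0] by simp

text \<open>Multiplicativity makes the image of 1 idempotent, hence 0 or 1; strict monotonicity
  excludes 0.\<close>

lemma hypreal_of_1: "hypreal_of star 1 = 1"
  using hypreal_of_mult[of 1 1] hypreal_of_less[of 0 1] by (simp add: hypreal_of_0)

lemma hypreal_of_uminus: "hypreal_of star (- a) = - hypreal_of star a"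
  using hypreal_of_add[of a "- a"] by (simp add: hypreal_of_0 eq_neg_iff_add_eq_0 add.commute)

lemma hypreal_of_diff: "hypreal_of star (a - b) = hypreal_of star a - hypreal_of star b"
  using hypreal_of_add[of a "- b"] by (simp add: hypreal_of_uminus)

lemma hypreal_of_of_nat: "hypreal_of star (of_nat n) = of_nat n"
  by (induction n) (simp_all add: hypreal_of_0 hypreal_of_1 hypreal_of_add)

text \<open>Terms have no division symbol, so quotients enter formulas through this function symbol;
  its interpretation has to match the field operation used in
  \<open>inverse_hypcomplex\<close>.\<close>

lemma star_inverse: "star (\<lambda>xs. inverse (hd xs)) [y] = inverse y"
proof -
  let ?inv = "Fun (\<lambda>xs. inverse (hd xs)) [Var 0]"
  have "sat star (\<lambda>n. hypreal_of star 0)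
      (All 0 (Neg (Conj (Neg (Eq (Var 0) (const 0))) (Neg (Eq (Mul (Var 0) ?inv) (const 1))))))"
    by (rule transferD[OF transfer]) (simp add: disj_imp)
  then have nonzero: "y \<noteq> 0 \<Longrightarrow> y * star (\<lambda>xs. inverse (hd xs)) [y] = 1"
    by (auto simp: star_const hypreal_of_0 hypreal_of_1)
  \<comment> \<open>The equation \<open>y * inverse y = 1\<close> says nothing at 0, so the
    convention \<open>inverse 0 = 0\<close> is transferred separately.\<close>
  have "sat star (\<lambda>n. hypreal_of star 0)
      (All 0 (Neg (Conj (Eq (Var 0) (const 0)) (Neg (Eq ?inv (const 0))))))"
    by (rule transferD[OF transfer]) simp
  then have "star (\<lambda>xs. inverse (hd xs)) [0] = 0"
    by (simp add: star_const hypreal_of_0)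
  with nonzero show ?thesis
    by (cases "y = 0") (auto dest: inverse_unique)
qed

lemma transfer_eventually_at:
  assumes "eventually (\<lambda>t. sat (\<lambda>f. f) (v(n := t)) \<phi>) (at t0)"
    and "\<Delta>t \<in> infinitesimals star - {0}"
  shows "sat star ((\<lambda>m. hypreal_of star (v m))(n := hypreal_of star t0 + \<Delta>t)) \<phi>"
proof -
  obtain \<delta> where \<delta>: "\<delta> > 0"
    and near: "\<And>t. t \<noteq> t0 \<Longrightarrow> dist t t0 < \<delta> \<Longrightarrow> sat (\<lambda>f. f) (v(n := t)) \<phi>"
    using assms(1) by (auto simp: eventually_at)
  \<comment> \<open>The real \<delta> is fixed before transfer, so its punctured interval around
    \<open>t0\<close> is definable with constants as endpoints. After transfer the quantifier also
    reaches \<open>t0 + \<Delta>t\<close>, which lies in the interval because \<Delta>t is non-zero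
    and smaller than the image of \<delta>.\<close>
  have "sat star (\<lambda>m. hypreal_of star (v m))
      (All n (Neg (Conj (Conj (Neg (Eq (Var n) (const t0)))
        (Conj (Less (const (t0 - \<delta>)) (Var n)) (Less (Var n) (const (t0 + \<delta>))))) (Neg \<phi>))))"
    by (rule transferD[OF transfer]) (auto intro!: near simp: dist_real_def)
  moreover have "\<bar>\<Delta>t\<bar> < hypreal_of star \<delta>" "\<Delta>t \<noteq> 0"
    using assms(2) \<delta> by (auto simp: infinitesimals_def)
  ultimately show ?thesis
    by (auto simp: star_const hypreal_of_add hypreal_of_diff abs_less_iff
        dest: spec[of _ "hypreal_of star t0 + \<Delta>t"])
qed

text \<open>Distinct complex numbers are a positive real distance apart. The discs of half that
  radius around them are disjoint, and by transfer no hypercomplex number lies in both enlarged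
  discs.\<close>

lemma infinitely_close_unique:
  assumes "infinitely_close star z (hypcomplex_of star w)"
    and "infinitely_close star z (hypcomplex_of star w')"
  shows "w = w'"
proof (rule ccontr)
  assume "w \<noteq> w'"
  define r where "r = cmod (w - w') / 2"
  have "r > 0" using \<open>w \<noteq> w'\<close> by (simp add: r_def)
  let ?less = "\<lambda>u. Less (Fun (\<lambda>xs. cmod (Complex (xs ! 0) (xs ! 1)))
      [Add (Var 0) (const (- Re u)), Add (Var 1) (const (- Im u))]) (const r)"
  have "\<not> (cmod (Complex (x - Re w) (y - Im w)) < r \<and> cmod (Complex (x - Re w') (y - Im w')) < r)"
    for x y
  proof -
    have "Complex (x - Re u) (y - Im u) = Complex x y - u" for u
      by (simp add: complex_eq_iff)
    then show ?thesis
      using norm_triangle_ineq4[of "Complex x y - w'" "Complex x y - w"] by (auto simp: r_def)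
  qed
  then have no_both: "sat star (\<lambda>_. hypreal_of star 0) (All 0 (All 1 (Neg (Conj (?less w) (?less w')))))"
    by (intro transferD[OF transfer]) simp
  have less: "hypcmod star (z - hypcomplex_of star u) < hypreal_of star r"
    if "infinitely_close star z (hypcomplex_of star u)" for u
  proof -
    have "\<bar>hypcmod star (z - hypcomplex_of star u)\<bar> < hypreal_of star r"
      using that \<open>r > 0\<close> by (auto simp: infinitely_close_def infinitesimals_def)
    then show ?thesis by (simp add: abs_less_iff)
  qed
  from no_both less[OF assms(1)] less[OF assms(2)] show False
    by (auto simp: hypcmod_def hypcomplex_of_def minus_hypcomplex_def
        star_const hypreal_of_uminus)
qed

text \<open>Since \<open>shadow\<close> is a definite description, uniqueness makes any complex
  number infinitely close to \<open>z\<close> its value.\<close>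

lemma shadow_eqI: "infinitely_close star z (hypcomplex_of star w) \<Longrightarrow> shadow star z = w"
  unfolding shadow_def using infinitely_close_unique by blast

text \<open>Infinitesimals are defined by bounds on the absolute value, whereas the transferred
  estimates bound \<open>hypcmod\<close> itself.\<close>

lemma hypcmod_nonneg: "0 \<le> hypcmod star z"
proof -
  have "sat star (\<lambda>_. hypreal_of star 0)
      (All 0 (All 1 (Neg (Less (Fun (\<lambda>xs. cmod (Complex (xs ! 0) (xs ! 1))) [Var 0, Var 1])
        (const 0)))))"
    by (rule transferD[OF transfer]) simp
  then show ?thesis
    by (simp add: hypcmod_def star_const hypreal_of_0 not_less)
qed

lemma fun_extension_nonzero:
  assumes "eventually (\<lambda>t. g t \<noteq> 0) (at t0)" "\<Delta>t \<in> infinitesimals star - {0}"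
  shows "fun_extension star g (hypreal_of star t0 + \<Delta>t) \<noteq> 0"
proof -
  have "eventually (\<lambda>t. sat (\<lambda>f. f) ((\<lambda>_. 0)(0 := t))
      (Neg (Conj (Eq (Fun (\<lambda>xs. Re (g (hd xs))) [Var 0]) (const 0))
        (Eq (Fun (\<lambda>xs. Im (g (hd xs))) [Var 0]) (const 0))))) (at t0)"
    using assms(1) by (simp add: complex_eq_iff)
  from transfer_eventually_at[OF this assms(2)] show ?thesis
    by (simp add: fun_extension_def zero_hypcomplex_def star_const hypreal_of_0)
qed

lemma in_enlargement:
  assumes "eventually (\<lambda>t. t \<in> D) (at t0)" "\<Delta>t \<in> infinitesimals star - {0}"
  shows "hypreal_of star t0 + \<Delta>t \<in> enlargement star D"
proof -
  have "eventually (\<lambda>t. sat (\<lambda>f. f) ((\<lambda>_. 0)(0 := t))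
      (Eq (Fun (\<lambda>xs. if hd xs \<in> D then 1 else 0) [Var 0]) (const 1))) (at t0)"
    using assms(1) by simp
  from transfer_eventually_at[OF this assms(2)] show ?thesis
    by (simp add: enlargement_def star_const hypreal_of_1)
qed

text \<open>The language speaks of reals only, so the complex quotient is spelled out as numerator
  times conjugate denominator over squared modulus. Unfolding hypercomplex division yields the same
  expression.\<close>

lemma hypcmod_quotient_diff_less:
  assumes "eventually (\<lambda>t. cmod (f t / g t - w) < r) (at t0)"
    and "\<Delta>t \<in> infinitesimals star - {0}"
  shows "hypcmod star (fun_extension star f (hypreal_of star t0 + \<Delta>t)
      / fun_extension star g (hypreal_of star t0 + \<Delta>t) - hypcomplex_of star w) < hypreal_of star r"
proof -
  let ?a = "Fun (\<lambda>xs. Re (f (hd xs))) [Var 0]" and ?b = "Fun (\<lambda>xs. Im (f (hd xs))) [Var 0]"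
  let ?c = "Fun (\<lambda>xs. Re (g (hd xs))) [Var 0]" and ?d = "Fun (\<lambda>xs. Im (g (hd xs))) [Var 0]"
  let ?inv = "Fun (\<lambda>xs. inverse (hd xs)) [Add (Mul ?c ?c) (Mul ?d ?d)]"
  let ?re = "Mul (Add (Mul ?a ?c) (Mul ?b ?d)) ?inv"
  let ?im = "Mul (Add (Mul ?b ?c) (Mul (const (- 1)) (Mul ?a ?d))) ?inv"
  let ?\<phi> = "Less (Fun (\<lambda>xs. cmod (Complex (xs ! 0) (xs ! 1)))
      [Add ?re (const (- Re w)), Add ?im (const (- Im w))]) (const r)"
  \<comment> \<open>This also covers \<open>v = 0\<close>, where division by zero makes both sides
    equal to \<open>- w\<close>.\<close>
  have "Complex ((Re u * Re v + Im u * Im v) * inverse (Re v * Re v + Im v * Im v) - Re w)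
      ((Im u * Re v - Re u * Im v) * inverse (Re v * Re v + Im v * Im v) - Im w) = u / v - w" for u v
    by (simp add: complex_eq_iff Re_divide Im_divide power2_eq_square divide_inverse algebra_simps)
  with assms(1) have "eventually (\<lambda>t. sat (\<lambda>f. f) ((\<lambda>_. 0)(0 := t)) ?\<phi>) (at t0)"
    by simp
  from transfer_eventually_at[OF this assms(2)] show ?thesis
    by (simp add: hypcmod_def fun_extension_def hypcomplex_of_def minus_hypcomplex_def
        divide_hypcomplex_def times_hypcomplex_def inverse_hypcomplex_def star_inverse
        star_const hypreal_of_uminus hypreal_of_1 power2_eq_square divide_inverse
        algebra_simps)
qed

text \<open>The limit supplies one estimate for each real \<open>r > 0\<close>; each is transferred
  on its own, and together they say that the difference is infinitesimal.\<close>

lemma infinitely_close_quotient: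
  assumes "((\<lambda>t. f t / g t) \<longlongrightarrow> w) (at t0)" "\<Delta>t \<in> infinitesimals star - {0}"
  shows "infinitely_close star (fun_extension star f (hypreal_of star t0 + \<Delta>t)
      / fun_extension star g (hypreal_of star t0 + \<Delta>t)) (hypcomplex_of star w)"
  using assms hypcmod_nonneg
  by (auto simp: infinitely_close_def infinitesimals_def tendsto_iff dist_norm abs_of_nonneg
      intro!: hypcmod_quotient_diff_less)

lemma limited_quotient:
  assumes "((\<lambda>t. f t / g t) \<longlongrightarrow> w) (at t0)" "\<Delta>t \<in> infinitesimals star - {0}"
  shows "limited star (fun_extension star f (hypreal_of star t0 + \<Delta>t)
      / fun_extension star g (hypreal_of star t0 + \<Delta>t))"
proof -
  obtain n :: nat where n: "cmod w < real n"
    using reals_Archimedean2 by blast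
  have "eventually (\<lambda>t. cmod (f t / g t) < real n) (at t0)"
    by (rule order_tendstoD(2)[OF tendsto_norm[OF assms(1)] n])
  \<comment> \<open>Subtracting 0 casts the bound as the previous estimate with centre 0 and radius
    \<open>n\<close>.\<close>
  then have "eventually (\<lambda>t. cmod (f t / g t - 0) < real n) (at t0)"
    by simp
  from hypcmod_quotient_diff_less[OF this assms(2)] show ?thesis
    by (auto simp: limited_def hypreal_of_of_nat hypcomplex_of_def hypreal_of_0
        minus_hypcomplex_def)
qed

end

text \<open>Around an interior point, continuity relative to \<open>S\<close> is ordinary
  continuity, and near \<open>t0\<close> the function \<Theta> coincides with the quotient, whose
  limit is therefore the value of \<Theta> at \<open>t0\<close>.\<close>

lemma fractional_continuation_tendsto:
  assumes "fractional_continuation S \<Psi> t0 \<epsilon> i \<Theta>" "t0 \<in> interior S"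
  shows "((\<lambda>t. \<Psi> t $ j / \<Psi> t $ i) \<longlongrightarrow> \<Theta> t0 $ j) (at t0)"
    and "eventually (\<lambda>t. \<Psi> t $ i \<noteq> 0) (at t0)"
proof -
  let ?U = "interior S \<inter> ball t0 \<epsilon>"
  have cont: "continuous_on (S \<inter> ball t0 \<epsilon>) \<Theta>" and "\<epsilon> > 0"
    and nz: "\<And>t. t \<in> S \<inter> ball t0 \<epsilon> - {t0} \<Longrightarrow> \<Psi> t $ i \<noteq> 0"
    and eq: "\<And>t. t \<in> S \<inter> ball t0 \<epsilon> - {t0} \<Longrightarrow> \<Theta> t = (\<chi> j. \<Psi> t $ j / \<Psi> t $ i)"
    using assms(1) by (auto simp: fractional_continuation_def selected_component_def)
  have U: "open ?U" "t0 \<in> ?U" "?U \<subseteq> S \<inter> ball t0 \<epsilon>"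
    using assms(2) \<open>\<epsilon> > 0\<close> interior_subset by auto
  have ev: "eventually (\<lambda>t. t \<in> S \<inter> ball t0 \<epsilon> - {t0}) (at t0)"
    unfolding eventually_at_topological using U by blast
  have "isCont \<Theta> t0"
    using continuous_on_subset[OF cont U(3)] U(1,2) by (simp add: continuous_on_eq_continuous_at)
  then have "((\<lambda>t. \<Theta> t $ j) \<longlongrightarrow> \<Theta> t0 $ j) (at t0)"
    by (auto simp: isCont_def intro: tendsto_vec_nth)
  moreover have "eventually (\<lambda>t. \<Theta> t $ j = \<Psi> t $ j / \<Psi> t $ i) (at t0)"
    using ev by eventually_elim (simp add: eq)
  ultimately show "((\<lambda>t. \<Psi> t $ j / \<Psi> t $ i) \<longlongrightarrow> \<Theta> t0 $ j) (at t0)"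
    by (rule Lim_transform_eventually)
  show "eventually (\<lambda>t. \<Psi> t $ i \<noteq> 0) (at t0)"
    using ev by eventually_elim (rule nz)
qed

theorem theorem79:
  fixes star :: "(real list \<Rightarrow> real) \<Rightarrow> 'h::linordered_field list \<Rightarrow> 'h"
    and \<Psi> \<Theta> :: "real \<Rightarrow> complex ^ 'd"
    and t0 \<epsilon> :: real
    and i j :: 'd
    and \<Delta>t :: 'h
  assumes "nonstandard_extension star"
    and "continuous_on {0..1} \<Psi>"
    and "t0 \<in> {0<..<1}"
    and "fractionally_continuable {0..1} \<Psi> t0"
    and "fractional_continuation {0..1} \<Psi> t0 \<epsilon> i \<Theta>"
    and "\<Delta>t \<in> infinitesimals star - {0}"
  shows "hypreal_of star t0 + \<Delta>t \<in> enlargement star {0..1} \<and>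
    fun_extension star (\<lambda>t. \<Psi> t $ i) (hypreal_of star t0 + \<Delta>t) \<noteq> 0 \<and>
    limited star (fun_extension star (\<lambda>t. \<Psi> t $ j) (hypreal_of star t0 + \<Delta>t)
                / fun_extension star (\<lambda>t. \<Psi> t $ i) (hypreal_of star t0 + \<Delta>t)) \<and>
    \<Theta> t0 $ j =
      shadow star (fun_extension star (\<lambda>t. \<Psi> t $ j) (hypreal_of star t0 + \<Delta>t)
                 / fun_extension star (\<lambda>t. \<Psi> t $ i) (hypreal_of star t0 + \<Delta>t))"
proof -
  have transfer: "transfer_principle star"
    using assms(1) by (simp add: nonstandard_extension_def)
  have t0: "t0 \<in> interior {0..1}"
    using assms(3) by simp
  then have "eventually (\<lambda>t. t \<in> interior {0..1}) (at t0)"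
    using eventually_at_topological by blast
  then have "eventually (\<lambda>t. t \<in> {0..1}) (at t0)"
    by eventually_elim (use interior_subset in blast)
  \<comment> \<open>Membership in the enlarged interval ensures that the extensions are evaluated
    where only the values of \<Psi> on \<open>{0..1}\<close> matter.\<close>
  note in_enlargement[OF transfer this assms(6)]
  moreover note cont = fractional_continuation_tendsto[OF assms(5) t0]
  note fun_extension_nonzero[OF transfer cont(2) assms(6)]
  moreover note limited_quotient[OF transfer cont(1) assms(6)]
  moreover note shadow_eqI[OF transfer infinitely_close_quotient[OF transfer cont(1) assms(6)]]
  ultimately show ?thesis by simp
qed

end
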